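(* Let $p$ be a prime and let $G(p)$ denote the number of $h\in\{1,\ldots,p-1\}$ for which there exists some $g\in\{1,\ldots,p-1\}$ with $g^{h}\equiv h\pmod p$. Then \[ \left|G(p)-\sum_{e\mid p-1}\frac{1}{e}\,\phi\!\left(\frac{p-1}{e}\right)\right|\le d(p-1)^{2}\sqrt{p}\,(1+\ln p). \]
   Context: $\phi$ is Euler's totient function and $d(n)$ is the number of positive divisors of $n$; the sum runs over positive divisors $e$ of $p-1$. *)

theory Defs
  imports Complex_Main "HOL-Number_Theory.Number_Theory"
begin

definition divisor_count :: "nat \<Rightarrow> nat" where
  "divisor_count n = card {e. e dvd n}"

definition G :: "nat \<Rightarrow> nat" where
  "G p = card {h \<in> {1..p - 1}. \<exists>g \<in> {1..p - 1}. [g ^ h = h] (mod p)}"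

end

theory Submission
  imports Defs "HOL-Analysis.Analysis" "HOL-Library.Real_Mod"
begin

text \<open>
  Put \<open>n = p - 1\<close>. For \<open>gcd h n = e\<close> the congruence \<open>g ^ h \<equiv> h\<close> is solvable iff \<open>h\<close> is an \<open>e\<close>-th
  power residue. Writing \<open>h = e * a\<close> and removing the condition \<open>coprime a (n div e)\<close> by
  inclusion-exclusion, one has to count the multiples of some \<open>D dvd n\<close> up to \<open>n\<close> that lie in the
  subgroup \<open>H\<close> of \<open>e\<close>-th powers, with an error of at most \<open>sqrt p * (1 + ln p)\<close>. This is a
  Polya-Vinogradov estimate, but multiplicative characters and Gauss sums are not needed: the
  additive Fourier transform of the indicator of \<open>H\<close> is constant on cosets of \<open>H\<close>, so Parseval's
  identity alone bounds it by \<open>sqrt p\<close> away from 0.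
\<close>

section \<open>Additive characters modulo \<open>p\<close>\<close>

definition unit_char :: "nat \<Rightarrow> int \<Rightarrow> complex" where
  "unit_char p x = cis (2 * pi * real_of_int x / real p)"

lemma unit_char_0 [simp]: "unit_char p 0 = 1"
  by (simp add: unit_char_def)

lemma norm_unit_char [simp]: "cmod (unit_char p x) = 1"
  by (simp add: unit_char_def)

lemma unit_char_add: "unit_char p (x + y) = unit_char p x * unit_char p y"
  unfolding unit_char_def cis_mult by (simp add: add_divide_distrib ring_distribs)

lemma cnj_unit_char: "cnj (unit_char p x) = unit_char p (- x)"
  by (simp add: unit_char_def cis_cnj)

lemma unit_char_mult_nat: "unit_char p (x * int n) = unit_char p x ^ n"
  unfolding unit_char_def Complex.DeMoivre by (rule arg_cong[of _ _ cis]) simp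

lemma unit_char_eq_1_iff:
  assumes "p > 0"
  shows "unit_char p x = 1 \<longleftrightarrow> int p dvd x"
proof -
  have "unit_char p x = 1 \<longleftrightarrow> (\<exists>n. 2 * pi * real_of_int x / real p = of_int n * (2 * pi))"
    unfolding unit_char_def cis_eq_1_iff ..
  also have "\<dots> \<longleftrightarrow> (\<exists>n. real_of_int x = real_of_int (int p * n))"
    using assms by (simp add: field_simps)
  also have "\<dots> \<longleftrightarrow> int p dvd x"
    unfolding of_int_eq_iff dvd_def ..
  finally show ?thesis .
qed

lemma unit_char_cong:
  assumes "p > 0" "[x = y] (mod int p)"
  shows "unit_char p x = unit_char p y"
proof -
  have "unit_char p (x - y) = 1"
    using assms by (simp add: unit_char_eq_1_iff cong_iff_dvd_diff)
  then show ?thesis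
    using unit_char_add[of p "x - y" y] by simp
qed

text \<open>Orthogonality of the additive characters: a geometric series whose ratio is a
  \<open>p\<close>-th root of unity, either equal to 1 or summing to 0.\<close>

lemma sum_unit_char:
  assumes "p > 0"
  shows "(\<Sum>k<p. unit_char p (int k * x)) = (if int p dvd x then of_nat p else 0)"
proof -
  have "(\<Sum>k<p. unit_char p (int k * x)) = (\<Sum>k<p. unit_char p x ^ k)"
    by (simp add: unit_char_mult_nat mult.commute[of _ x])
  also have "\<dots> = (if int p dvd x then of_nat p else 0)"
  proof (cases "int p dvd x")
    case True
    then show ?thesis using assms by (simp add: unit_char_eq_1_iff[THEN iffD2])
  next
    case False
    have "unit_char p x ^ p = unit_char p (x * int p)"
      by (simp add: unit_char_mult_nat)
    also have "\<dots> = 1" using assms by (simp add: unit_char_eq_1_iff)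
    finally show ?thesis
      using False assms by (simp add: geometric_sum unit_char_eq_1_iff)
  qed
  finally show ?thesis .
qed

section \<open>Fourier analysis on residues modulo \<open>p\<close>\<close>

text \<open>The transform is unnormalised, so a factor \<open>p\<close> appears in inversion and in
  Parseval. Integer frequencies allow \<open>k * int h\<close> and negatives without reduction
  modulo \<open>p\<close>.\<close>

definition dft :: "nat \<Rightarrow> (nat \<Rightarrow> real) \<Rightarrow> int \<Rightarrow> complex" where
  "dft p f k = (\<Sum>x<p. of_real (f x) * unit_char p (k * int x))"

lemma dft_cong:
  assumes "p > 0" "[k = l] (mod int p)"
  shows "dft p f k = dft p f l"
  unfolding dft_def using assms
  by (intro sum.cong refl arg_cong2[of _ _ _ _ "(*)"] unit_char_cong cong_mult) auto

lemma dft_inversion: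
  assumes "x < p"
  shows "(\<Sum>k<p. dft p f (int k) * unit_char p (- (int k * int x))) = of_nat p * of_real (f x)"
proof -
  have "(\<Sum>k<p. dft p f (int k) * unit_char p (- (int k * int x)))
      = (\<Sum>k<p. \<Sum>y<p. of_real (f y) * unit_char p (int k * (int y - int x)))"
    unfolding dft_def sum_distrib_right
    by (simp add: mult.assoc right_diff_distrib flip: unit_char_add)
  also have "\<dots> = (\<Sum>y<p. of_real (f y) * (\<Sum>k<p. unit_char p (int k * (int y - int x))))"
    by (subst sum.swap) (simp add: sum_distrib_left)
  also have "\<dots> = (\<Sum>y<p. if y = x then of_nat p * of_real (f y) else 0)"
  proof (intro sum.cong refl)
    fix y assume "y \<in> {..<p}"
    then have "int p dvd int y - int x \<longleftrightarrow> y = x"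
      using assms by (auto simp flip: cong_iff_dvd_diff simp: cong_int_iff dest: cong_less_modulus_unique_nat)
    then show "of_real (f y) * (\<Sum>k<p. unit_char p (int k * (int y - int x)))
        = (if y = x then of_nat p * of_real (f y) else 0)"
      using assms by (simp add: sum_unit_char)
  qed
  also have "\<dots> = of_nat p * of_real (f x)"
    using assms by simp
  finally show ?thesis .
qed

lemma parseval_dft:
  "(\<Sum>k<p. (cmod (dft p f (int k)))\<^sup>2) = real p * (\<Sum>x<p. (f x)\<^sup>2)"
proof -
  have "complex_of_real (\<Sum>k<p. (cmod (dft p f (int k)))\<^sup>2)
      = (\<Sum>k<p. dft p f (int k) * cnj (dft p f (int k)))"
    unfolding of_real_sum by (intro sum.cong refl complex_norm_square)
  \<comment> \<open>Only the conjugated factor is expanded; the other stays a transform, so that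
    after swapping the sums the inner one is the inversion formula.\<close>
  also have "\<dots> = (\<Sum>k<p. \<Sum>x<p. of_real (f x) * (dft p f (int k) * unit_char p (- (int k * int x))))"
    by (subst (2) dft_def) (simp add: sum_distrib_left cnj_unit_char mult_ac)
  also have "\<dots> = (\<Sum>x<p. of_real (f x) * (\<Sum>k<p. dft p f (int k) * unit_char p (- (int k * int x))))"
    by (subst sum.swap) (simp add: sum_distrib_left)
  also have "\<dots> = (\<Sum>x<p. of_real (f x) * (of_nat p * of_real (f x)))"
    by (intro sum.cong refl) (simp add: dft_inversion)
  also have "\<dots> = complex_of_real (real p * (\<Sum>x<p. (f x)\<^sup>2))"
    by (simp add: sum_distrib_left power2_eq_square mult_ac)
  finally show ?thesis by (simp only: of_real_eq_iff)
qed

section \<open>Functions invariant under a multiplicative subgroup\<close>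

lemma bij_betw_mult_mod_prime:
  fixes p h :: nat
  assumes "prime p" "\<not> p dvd h"
  shows "bij_betw (\<lambda>x. h * x mod p) {..<p} {..<p}"
proof -
  have cop: "coprime h p"
    using prime_imp_coprime[OF assms] by (simp add: coprime_commute)
  have "inj_on (\<lambda>x. h * x mod p) {..<p}"
  proof (rule inj_onI)
    fix x y assume *: "x \<in> {..<p}" "y \<in> {..<p}" "h * x mod p = h * y mod p"
    then have "[h * x = h * y] (mod p)" by (simp add: Cong.cong_def)
    then have "[x = y] (mod p)" using cop by (simp add: cong_mult_lcancel_nat)
    with * show "x = y" by (auto dest: cong_less_modulus_unique_nat)
  qed
  moreover have "(\<lambda>x. h * x mod p) ` {..<p} \<subseteq> {..<p}"
    using assms prime_gt_0_nat by auto
  ultimately show ?thesis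
    by (simp add: bij_betw_def endo_inj_surj)
qed

text \<open>The substitution of \<open>h * x mod p\<close> for \<open>x\<close> permutes the
  residues; invariance removes \<open>h\<close> from the argument of \<open>f\<close> and leaves it
  in the frequency.\<close>

lemma dft_mult_invariant:
  assumes "prime p" "\<not> p dvd h" "\<And>x. x < p \<Longrightarrow> f (h * x mod p) = f x"
  shows "dft p f (k * int h) = dft p f k"
proof -
  have p0: "p > 0" using assms(1) prime_gt_0_nat by simp
  have "dft p f k = (\<Sum>x<p. of_real (f (h * x mod p)) * unit_char p (k * int (h * x mod p)))"
    unfolding dft_def
    by (rule sum.reindex_bij_betw[OF bij_betw_mult_mod_prime[OF assms(1,2)], symmetric])
  also have "\<dots> = dft p f (k * int h)"
    unfolding dft_def
  proof (intro sum.cong refl arg_cong2[of _ _ _ _ "(*)"])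
    fix x assume x: "x \<in> {..<p}"
    show "complex_of_real (f (h * x mod p)) = of_real (f x)"
      using assms(3) x by simp
    show "unit_char p (k * int (h * x mod p)) = unit_char p (k * int h * int x)"
      using p0 by (intro unit_char_cong)
        (simp_all add: of_nat_mod mult.assoc cong_scalar_left)
  qed
  finally show ?thesis ..
qed

text \<open>The transform is constant on the orbit of \<open>k\<close> under \<open>H\<close>, so each of its values there
  accounts for at most a \<open>1 / card H\<close> share of the Parseval sum.\<close>

lemma norm_dft_le_sqrt:
  assumes "prime p" "H \<subseteq> {1..<p}" "H \<noteq> {}"
    and inv: "\<And>h x. h \<in> H \<Longrightarrow> x < p \<Longrightarrow> f (h * x mod p) = f x"
    and L2: "(\<Sum>x<p. (f x)\<^sup>2) \<le> real (card H)"
    and k: "\<not> p dvd k"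
  shows "cmod (dft p f (int k)) \<le> sqrt (real p)"
proof -
  have p0: "p > 0" using assms(1) prime_gt_0_nat by simp
  have fin: "finite H" using assms(2) finite_subset by blast
  have inj: "inj_on (\<lambda>h. k * h mod p) H"
    using bij_betw_mult_mod_prime[OF assms(1) k] assms(2)
    by (auto simp: bij_betw_def intro!: inj_on_subset[of _ "{..<p}" H])
  have "real (card H) * (cmod (dft p f (int k)))\<^sup>2 = (\<Sum>h\<in>H. (cmod (dft p f (int (k * h mod p))))\<^sup>2)"
  proof -
    have "dft p f (int (k * h mod p)) = dft p f (int k)" if "h \<in> H" for h
    proof -
      have "dft p f (int (k * h mod p)) = dft p f (int k * int h)"
        using p0 by (intro dft_cong) (simp_all add: Cong.cong_def of_nat_mod)
      also have "\<dots> = dft p f (int k)"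
      proof (rule dft_mult_invariant)
        show "\<not> p dvd h" using that assms(2) by (auto dest!: dvd_imp_le)
      qed (use that inv assms(1) in auto)
      finally show ?thesis .
    qed
    then show ?thesis by simp
  qed
  also have "\<dots> = (\<Sum>l\<in>(\<lambda>h. k * h mod p) ` H. (cmod (dft p f (int l)))\<^sup>2)"
    by (simp add: sum.reindex[OF inj])
  also have "\<dots> \<le> (\<Sum>l<p. (cmod (dft p f (int l)))\<^sup>2)"
    using p0 by (intro sum_mono2) auto
  also have "\<dots> \<le> real p * real (card H)"
    unfolding parseval_dft using L2 by (intro mult_left_mono) auto
  finally have "(cmod (dft p f (int k)))\<^sup>2 \<le> real p"
    using fin assms(3) by (simp add: mult.commute[of "real p"] card_gt_0_iff)
  then show ?thesis by (rule real_le_rsqrt)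
qed

section \<open>Geometric sums of characters and harmonic numbers\<close>

text \<open>Jordan's inequality: by concavity, sine lies above its chord from 0 to
  \<open>pi / 2\<close>.\<close>

lemma sin_pi_mult_ge:
  fixes x :: real
  assumes "0 \<le> x" "x \<le> 1 / 2"
  shows "sin (pi * x) \<ge> 2 * x"
proof -
  have "convex_on {0..pi} (\<lambda>x. - sin x)"
    by (rule f''_ge0_imp_convex[where f' = "\<lambda>x. - cos x" and f'' = sin])
       (auto intro!: derivative_eq_intros sin_ge_zero)
  \<comment> \<open>The point \<open>pi * x\<close> divides the segment from 0 to
    \<open>pi / 2\<close> with weight \<open>2 * x\<close>.\<close>
  from convex_onD[OF this, of "2 * x" 0 "pi / 2"] show ?thesis
    using assms by (simp add: mult_ac)
qed

text \<open>Jordan's inequality, applied to \<open>x\<close> or to \<open>1 - x\<close>, gives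
  \<open>sin (pi * x) \<ge> 2 * x * (1 - x)\<close>; the reciprocal of the right side splits into
  partial fractions.\<close>

lemma inverse_sin_pi_mult_le:
  fixes x :: real
  assumes "0 < x" "x < 1"
  shows "1 / sin (pi * x) \<le> (1 / x + 1 / (1 - x)) / 2"
proof -
  have *: "sin (pi * x) \<ge> 2 * x * (1 - x)"
  proof (cases "x \<le> 1 / 2")
    case True
    have "2 * x * (1 - x) \<le> 2 * x * 1" using assms by (intro mult_left_mono) auto
    also have "\<dots> \<le> sin (pi * x)" using sin_pi_mult_ge[of x] True assms by simp
    finally show ?thesis .
  next
    case False
    have "2 * x * (1 - x) \<le> 2 * (1 - x)"
      using assms mult_right_mono[of x 1 "2 * (1 - x)"] by (simp add: mult_ac)
    also have "\<dots> \<le> sin (pi * (1 - x))" using sin_pi_mult_ge[of "1 - x"] False assms by simp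
    also have "\<dots> = sin (pi * x)" by (simp add: right_diff_distrib)
    finally show ?thesis .
  qed
  have pos: "0 < 2 * x * (1 - x)" using assms by simp
  have "1 / sin (pi * x) \<le> 1 / (2 * x * (1 - x))"
    using * pos by (intro divide_left_mono) (auto intro!: mult_pos_pos)
  also have "\<dots> = (1 / x + 1 / (1 - x)) / 2"
    using assms by (simp add: field_simps)
  finally show ?thesis .
qed

lemma norm_one_minus_cis: "cmod (1 - cis t) = 2 * \<bar>sin (t / 2)\<bar>"
proof -
  have "(cmod (1 - cis t))\<^sup>2 = (1 - cos t)\<^sup>2 + (sin t)\<^sup>2"
    by (simp add: cmod_power2)
  also have "\<dots> = 2 - 2 * cos t"
    using sin_cos_squared_add[of t] by (simp add: power2_eq_square algebra_simps)
  also have "cos t = 1 - 2 * (sin (t / 2))\<^sup>2"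
    using cos_double_sin[of "t / 2"] by simp
  also have "2 - 2 * (1 - 2 * (sin (t / 2))\<^sup>2) = (2 * \<bar>sin (t / 2)\<bar>)\<^sup>2"
    by (simp add: power_mult_distrib)
  finally show ?thesis by (rule power2_eq_imp_eq) auto
qed

text \<open>A geometric sum with ratio \<open>z\<close> on the unit circle is at most
  \<open>2 / cmod (1 - z)\<close>, whatever its length. The resulting \<open>1 / sin\<close> is
  traded for reciprocals, which are easy to sum over \<open>r\<close>.\<close>

lemma norm_sum_unit_char_le:
  assumes "0 < r" "r < p" "[m = int r] (mod int p)"
  shows "cmod (\<Sum>a=1..N. unit_char p (- (m * int a))) \<le> real p / 2 * (1 / real r + 1 / real (p - r))"
proof -
  define z where "z = unit_char p (- int r)"
  define x where "x = real r / real p"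
  have x: "0 < x" "x < 1" using assms by (auto simp: x_def)
  have z: "cmod (1 - z) = 2 * sin (pi * x)"
  proof -
    \<comment> \<open>Conjugation flips the sign of the exponent, so that the angle becomes
      \<open>2 * pi * x\<close>.\<close>
    have "cmod (1 - z) = cmod (cnj (1 - z))" by (rule complex_mod_cnj[symmetric])
    also have "\<dots> = cmod (1 - cis (2 * pi * x))"
      by (simp add: z_def cnj_unit_char) (simp add: unit_char_def x_def)
    also have "\<dots> = 2 * \<bar>sin (pi * x)\<bar>" by (simp add: norm_one_minus_cis)
    also have "\<bar>sin (pi * x)\<bar> = sin (pi * x)" using x by (intro abs_of_nonneg sin_ge_zero) auto
    finally show ?thesis .
  qed
  have sin_pos: "sin (pi * x) > 0" using x by (intro sin_gt_zero) auto
  then have z1: "z \<noteq> 1" using z by auto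
  have nz: "cmod z = 1" by (simp add: z_def)
  have "(\<Sum>a=1..N. unit_char p (- (m * int a))) = (\<Sum>a=1..N. z ^ a)"
  proof (intro sum.cong refl)
    fix a
    have "unit_char p (- (m * int a)) = unit_char p (- int r * int a)"
    proof (rule unit_char_cong)
      have "[- (m * int a) = - (int r * int a)] (mod int p)"
        using assms(3) by (simp add: cong_minus_minus_iff cong_scalar_right)
      then show "[- (m * int a) = - int r * int a] (mod int p)" by simp
    qed (use assms in auto)
    then show "unit_char p (- (m * int a)) = z ^ a"
      by (simp only: z_def unit_char_mult_nat)
  qed
  also have "\<dots> = (\<Sum>a<N. z * z ^ a)"
    by (simp add: sum.atLeast1_atMost_eq)
  also have "\<dots> = z * ((z ^ N - 1) / (z - 1))"
    using z1 by (simp add: geometric_sum flip: sum_distrib_left)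
  finally have "cmod (\<Sum>a=1..N. unit_char p (- (m * int a))) = cmod (z ^ N - 1) / cmod (1 - z)"
    by (simp add: norm_mult norm_divide nz norm_minus_commute)
  also have "\<dots> \<le> 2 / cmod (1 - z)"
    using norm_triangle_ineq4[of "z ^ N" 1]
    by (intro divide_right_mono) (auto simp: norm_power nz)
  also have "\<dots> = 1 / sin (pi * x)" by (simp add: z)
  also have "\<dots> \<le> (1 / x + 1 / (1 - x)) / 2" using x by (rule inverse_sin_pi_mult_le)
  also have "\<dots> = real p / 2 * (1 / real r + 1 / real (p - r))"
    using assms by (simp add: x_def field_simps of_nat_diff)
  finally show ?thesis .
qed

text \<open>The difference \<open>harm n - ln n\<close> decreases from its value 1 at
  \<open>n = 1\<close>.\<close>

lemma harm_le_one_plus_ln: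
  assumes "n > 0"
  shows "harm n \<le> 1 + ln (real n)"
proof -
  have "harm (Suc (n - 1)) - ln (real (Suc (n - 1))) \<le> harm (Suc 0) - ln (real (Suc 0))"
    using decseq_harm_diff_ln by (rule decseqD) simp
  with assms show ?thesis by (simp add: harm_def)
qed

lemma sum_reciprocal_symmetric:
  assumes "p > 0"
  shows "(\<Sum>r\<in>{1..<p}. real p / 2 * (1 / real r + 1 / real (p - r))) = real p * harm (p - 1)"
proof -
  have eq: "{1..<p} = {1..p - 1}" using assms by auto
  have 1: "(\<Sum>r\<in>{1..<p}. 1 / real r) = harm (p - 1)"
    unfolding eq harm_def by (simp add: inverse_eq_divide)
  have 2: "(\<Sum>r\<in>{1..<p}. 1 / real (p - r)) = (\<Sum>r\<in>{1..<p}. 1 / real r)"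
    by (rule sum.reindex_bij_witness[of _ "\<lambda>r. p - r" "\<lambda>r. p - r"]) auto
  show ?thesis
    unfolding sum_distrib_left[symmetric] sum.distrib 2 1 by simp
qed

section \<open>The Polya-Vinogradov estimate for invariant functions\<close>

text \<open>Completion of the sum: after Fourier inversion, each nonzero frequency contributes a
  coefficient of size at most \<open>sqrt p\<close> times a geometric sum. The bounds of the
  geometric sums add up to \<open>p * harm (p - 1)\<close>, and this \<open>p\<close> cancels the
  one from inversion.\<close>

lemma incomplete_sum_le:
  assumes "prime p" "H \<subseteq> {1..<p}" "H \<noteq> {}"
    and inv: "\<And>h x. h \<in> H \<Longrightarrow> x < p \<Longrightarrow> f (h * x mod p) = f x"
    and L2: "(\<Sum>x<p. (f x)\<^sup>2) \<le> real (card H)"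
    and mean: "(\<Sum>x<p. f x) = 0"
    and D: "\<not> p dvd D"
  shows "\<bar>\<Sum>a=1..N. f (D * a mod p)\<bar> \<le> sqrt (real p) * (1 + ln (real p))"
proof -
  have p1: "p > 1" using assms(1) prime_gt_1_nat by simp
  define b where "b = (\<lambda>r. real p / 2 * (1 / real r + 1 / real (p - r)))"
  define S where "S = (\<lambda>k. \<Sum>a=1..N. unit_char p (- (int (D * k) * int a)))"
  have "complex_of_real (real p * (\<Sum>a=1..N. f (D * a mod p)))
      = (\<Sum>a=1..N. \<Sum>k<p. dft p f (int k) * unit_char p (- (int k * int (D * a mod p))))"
    using p1 by (simp add: sum_distrib_left dft_inversion)
  also have "\<dots> = (\<Sum>a=1..N. \<Sum>k<p. dft p f (int k) * unit_char p (- (int (D * k) * int a)))"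
  proof (intro sum.cong refl arg_cong2[of _ _ _ _ "(*)"] unit_char_cong)
    fix a k
    have "[int k * int (D * a mod p) = int k * int (D * a)] (mod int p)"
      by (intro cong_scalar_left) (simp add: of_nat_mod Cong.cong_def)
    then have "[- (int k * int (D * a mod p)) = - (int k * int (D * a))] (mod int p)"
      by (simp only: cong_minus_minus_iff)
    then show "[- (int k * int (D * a mod p)) = - (int (D * k) * int a)] (mod int p)"
      by (simp add: mult_ac)
  qed (use p1 in auto)
  also have "\<dots> = (\<Sum>k<p. dft p f (int k) * S k)"
    unfolding S_def by (subst sum.swap) (simp only: sum_distrib_left)
  \<comment> \<open>At frequency 0 the sum \<open>S 0\<close> has no cancellation, but the
    coefficient there is the total of \<open>f\<close>, which vanishes.\<close>
  also have "\<dots> = (\<Sum>k\<in>{1..<p}. dft p f (int k) * S k)"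
  proof -
    have "dft p f 0 = of_real (\<Sum>x<p. f x)" by (simp add: dft_def)
    then have "dft p f 0 = 0" using mean by simp
    moreover have "{..<p} = insert 0 {1..<p}" using p1 by auto
    ultimately show ?thesis by simp
  qed
  finally have "real p * \<bar>\<Sum>a=1..N. f (D * a mod p)\<bar> = cmod (\<Sum>k\<in>{1..<p}. dft p f (int k) * S k)"
    by (metis norm_of_real abs_mult abs_of_nat)
  also have "\<dots> \<le> (\<Sum>k\<in>{1..<p}. cmod (dft p f (int k) * S k))" by (rule norm_sum)
  also have "\<dots> \<le> (\<Sum>k\<in>{1..<p}. sqrt (real p) * b (D * k mod p))"
    unfolding norm_mult
  proof (intro sum_mono mult_mono)
    fix k assume k: "k \<in> {1..<p}"
    then have k': "\<not> p dvd k" by (auto dest: dvd_imp_le)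
    show "cmod (dft p f (int k)) \<le> sqrt (real p)"
      using norm_dft_le_sqrt[OF assms(1-3) inv L2 k'] by simp
    have "\<not> p dvd D * k" using D k' assms(1) by (simp add: prime_dvd_mult_iff)
    then show "cmod (S k) \<le> b (D * k mod p)"
      unfolding S_def b_def using p1
      by (intro norm_sum_unit_char_le) (auto simp: Cong.cong_def of_nat_mod mod_greater_zero_iff_not_dvd)
  qed auto
  also have "\<dots> = sqrt (real p) * (\<Sum>k\<in>{1..<p}. b (D * k mod p))"
    by (simp add: sum_distrib_left)
  \<comment> \<open>Multiplication by \<open>D\<close> permutes the nonzero residues, so the bound
    does not depend on \<open>D\<close>.\<close>
  also have "(\<Sum>k\<in>{1..<p}. b (D * k mod p)) = (\<Sum>r\<in>{1..<p}. b r)"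
  proof (rule sum.reindex_bij_betw)
    have "bij_betw (\<lambda>x. D * x mod p) ({..<p} - {0}) ({..<p} - {D * 0 mod p})"
      by (rule bij_betw_DiffI[OF bij_betw_mult_mod_prime[OF assms(1) D]]) (use p1 in auto)
    moreover have "{..<p} - {0} = {1..<p}" by auto
    ultimately show "bij_betw (\<lambda>x. D * x mod p) {1..<p} {1..<p}" by simp
  qed
  also have "\<dots> = real p * harm (p - 1)"
    unfolding b_def using p1 by (intro sum_reciprocal_symmetric) simp
  also have "harm (p - 1) \<le> 1 + ln (real p)"
    using harm_le_one_plus_ln[of p] harm_mono[of "p - 1" p, where ?'a = real] p1 by simp
  finally show ?thesis using p1 by (simp add: mult_ac)
qed

section \<open>Power residues modulo a prime\<close>

definition power_residues :: "nat \<Rightarrow> nat \<Rightarrow> nat set" where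
  "power_residues p e = {x \<in> {1..<p}. \<exists>y. [y ^ e = x] (mod p)}"

lemma card_multiples_lessThan:
  fixes n e :: nat
  assumes "e dvd n" "n > 0"
  shows "card {i \<in> {..<n}. e dvd i} = n div e"
proof -
  have e0: "e > 0" using assms by (auto intro: Nat.gr0I)
  have "{i \<in> {..<n}. e dvd i} = (\<lambda>j. e * j) ` {..<n div e}"
    using assms e0 by (auto elim!: dvdE simp: image_iff)
  also have "card \<dots> = n div e"
    using e0 by (subst card_image) (auto simp: inj_on_def)
  finally show ?thesis .
qed

text \<open>For a primitive root \<open>g\<close>, the residue of \<open>g ^ i\<close> is an
  \<open>e\<close>-th power exactly when \<open>e\<close> divides \<open>i\<close>, because
  \<open>e\<close> divides \<open>p - 1\<close>. It remains to count the multiples of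
  \<open>e\<close> below \<open>p - 1\<close>.\<close>

lemma card_power_residues:
  assumes "prime p" "e dvd p - 1"
  shows "card (power_residues p e) = (p - 1) div e"
proof -
  have p1: "p > 1" using assms(1) prime_gt_1_nat by simp
  have e0: "e > 0" using assms(2) p1 by (auto intro: Nat.gr0I)
  obtain g where g: "residue_primroot p g"
    using prime_primitive_root_exists[OF p1 assms(1)] by blast
  have tot: "totient p = p - 1" using assms(1) by (rule totient_prime)
  have bij: "bij_betw (\<lambda>i. g ^ i mod p) {..<p - 1} {1..<p}"
    using residue_primroot_is_generator[OF p1 g] totatives_prime[OF assms(1)]
    by (simp add: tot greaterThanLessThan_def atLeastLessThan_def atLeast_Suc_greaterThan)
  have img: "(\<lambda>i. g ^ i mod p) ` {..<p - 1} = {1..<p}"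
    using bij by (rule bij_betw_imp_surj_on)
  have cop: "coprime p g" and ord: "ord p g = p - 1"
    using g by (simp_all add: residue_primroot_def tot)
  have "power_residues p e = (\<lambda>i. g ^ i mod p) ` {i \<in> {..<p - 1}. e dvd i}"
  proof (intro equalityI subsetI)
    fix x assume x: "x \<in> power_residues p e"
    then obtain y where y: "[y ^ e = x] (mod p)" and xr: "x \<in> {1..<p}"
      by (auto simp: power_residues_def)
    obtain i where i: "i < p - 1" "x = g ^ i mod p"
      using xr unfolding img[symmetric] by blast
    \<comment> \<open>The root \<open>y\<close> is an arbitrary natural number; before it can be
      written as a power of \<open>g\<close>, multiples of \<open>p\<close> are excluded, using
      \<open>e > 0\<close>.\<close>
    have "\<not> p dvd x" using xr by (auto dest: dvd_imp_le)
    then have "\<not> p dvd y"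
      using cong_dvd_iff[OF y] e0 dvd_trans[OF _ dvd_power[of e y]] by blast
    then have "y mod p \<in> {1..<p}"
      using p1 by (auto simp: Suc_le_eq mod_greater_zero_iff_not_dvd)
    then obtain j where j: "y mod p = g ^ j mod p"
      unfolding img[symmetric] by blast
    have "[g ^ (j * e) = g ^ i] (mod p)"
    proof -
      have "[(g ^ j) ^ e = y ^ e] (mod p)"
        using j by (intro cong_pow) (simp add: Cong.cong_def)
      also note y
      also have "[x = g ^ i] (mod p)" using i by (simp add: Cong.cong_def)
      finally show ?thesis by (simp add: power_mult)
    qed
    \<comment> \<open>Exponents of \<open>g\<close> are determined modulo its order
      \<open>p - 1\<close>, and the congruence descends to the divisor \<open>e\<close>.\<close>
    then have "[j * e = i] (mod (p - 1))"
      using order_divides_expdiff[OF cop] ord by simp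
    then have "[j * e = i] (mod e)"
      using assms(2) by (rule cong_dvd_modulus_nat)
    then have "e dvd i" using cong_dvd_iff by fastforce
    then show "x \<in> (\<lambda>i. g ^ i mod p) ` {i \<in> {..<p - 1}. e dvd i}"
      using i by auto
  next
    fix x assume "x \<in> (\<lambda>i. g ^ i mod p) ` {i \<in> {..<p - 1}. e dvd i}"
    then obtain j where j: "e * j < p - 1" "x = g ^ (e * j) mod p"
      by (auto elim!: dvdE)
    then have "x \<in> {1..<p}" unfolding img[symmetric] by blast
    moreover have "[(g ^ j) ^ e = x] (mod p)"
      using j by (simp add: Cong.cong_def mult.commute flip: power_mult)
    ultimately show "x \<in> power_residues p e"
      unfolding power_residues_def by blast
  qed
  moreover have "inj_on (\<lambda>i. g ^ i mod p) {i \<in> {..<p - 1}. e dvd i}"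
    using bij by (auto simp: bij_betw_def intro: inj_on_subset)
  ultimately show ?thesis
    using card_multiples_lessThan[OF assms(2)] p1 by (simp add: card_image)
qed

text \<open>Multiplication by \<open>h\<close> maps the set into itself and is injective, hence
  permutes it; this yields the forward implication without inverting \<open>h\<close>.\<close>

lemma mult_mod_in_power_residues_iff:
  assumes "prime p" "h \<in> power_residues p e" "x < p"
  shows "h * x mod p \<in> power_residues p e \<longleftrightarrow> x \<in> power_residues p e"
proof -
  define f where "f = (\<lambda>x. h * x mod p)"
  have p0: "p > 0" using assms(1) prime_gt_0_nat by simp
  have h: "\<not> p dvd h" using assms(2) by (auto simp: power_residues_def dest: dvd_imp_le)
  have sub: "power_residues p e \<subseteq> {..<p}" by (auto simp: power_residues_def)
  have inj: "inj_on f {..<p}"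
    using bij_betw_mult_mod_prime[OF assms(1) h] by (simp add: f_def bij_betw_def)
  have "f ` power_residues p e \<subseteq> power_residues p e"
  proof
    fix z assume "z \<in> f ` power_residues p e"
    then obtain x where x: "x \<in> power_residues p e" "z = h * x mod p" by (auto simp: f_def)
    then have "\<not> p dvd x" by (auto simp: power_residues_def dest: dvd_imp_le)
    then have "\<not> p dvd h * x" using h assms(1) by (simp add: prime_dvd_mult_iff)
    then have zr: "z \<in> {1..<p}"
      using p0 x by (auto simp: Suc_le_eq mod_greater_zero_iff_not_dvd)
    obtain y where y: "[y ^ e = x] (mod p)" using x by (auto simp: power_residues_def)
    obtain w where w: "[w ^ e = h] (mod p)" using assms(2) by (auto simp: power_residues_def)
    have "[(w * y) ^ e = h * x] (mod p)"
      unfolding power_mult_distrib using w y by (rule cong_mult)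
    then have "[(w * y) ^ e = z] (mod p)" using x by (simp add: Cong.cong_def)
    then show "z \<in> power_residues p e" using zr unfolding power_residues_def by blast
  qed
  then have "f ` power_residues p e = power_residues p e"
    using sub inj by (intro endo_inj_surj) (auto intro: inj_on_subset finite_subset)
  then have "f x \<in> power_residues p e \<longleftrightarrow> f x \<in> f ` power_residues p e" by simp
  also have "\<dots> \<longleftrightarrow> x \<in> power_residues p e"
    using inj sub assms(3) by (intro inj_on_image_mem_iff) auto
  finally show ?thesis by (simp add: f_def)
qed

text \<open>Bezout writes \<open>gcd h (p - 1)\<close> as \<open>h * u - (p - 1) * v\<close>, and Fermat removes the second term.\<close>

lemma ex_power_cong_iff:
  assumes "prime p" "x \<in> {1..<p}" "h > 0"
  shows "(\<exists>g\<in>{1..p - 1}. [g ^ h = x] (mod p)) \<longleftrightarrow> x \<in> power_residues p (gcd h (p - 1))"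
proof
  have p1: "p > 1" using assms(1) prime_gt_1_nat by simp
  have x: "\<not> p dvd x" using assms(2) by (auto dest: dvd_imp_le)
  define e where "e = gcd h (p - 1)"
  have e0: "e > 0" using assms(3) by (simp add: e_def)
  {
    assume "\<exists>g\<in>{1..p - 1}. [g ^ h = x] (mod p)"
    then obtain g where "[g ^ h = x] (mod p)" by blast
    moreover obtain u where "h = e * u" unfolding e_def using gcd_dvd1 by (rule dvdE)
    ultimately have "[(g ^ u) ^ e = x] (mod p)" by (simp add: mult.commute flip: power_mult)
    then show "x \<in> power_residues p (gcd h (p - 1))"
      using assms(2) unfolding power_residues_def e_def by blast
  }
  {
    assume "x \<in> power_residues p (gcd h (p - 1))"
    then obtain y where y: "[y ^ e = x] (mod p)" by (auto simp: power_residues_def e_def)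
    then have "\<not> p dvd y"
      using x cong_dvd_iff[OF y] e0 dvd_trans[OF _ dvd_power[of e y]] by blast
    then have fermat: "[y ^ (p - 1) = 1] (mod p)" using fermat_theorem assms(1) by blast
    obtain u v where uv: "h * u = (p - 1) * v + e"
      using bezout_nat[of h "p - 1"] assms(3) by (auto simp: e_def)
    have "[(y ^ u) ^ h = x] (mod p)"
    proof -
      have "(y ^ u) ^ h = (y ^ (p - 1)) ^ v * y ^ e"
        by (simp add: uv mult.commute[of u h] flip: power_mult power_add)
      also have "[\<dots> = 1 ^ v * x] (mod p)"
        using fermat y by (intro cong_mult cong_pow)
      finally show ?thesis by simp
    qed
    then have *: "[(y ^ u mod p) ^ h = x] (mod p)"
      by (simp add: Cong.cong_def power_mod)
    have "\<not> p dvd y ^ u" using \<open>\<not> p dvd y\<close> assms(1) prime_dvd_power by blast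
    moreover have "y ^ u mod p \<le> p - 1"
      using p1 mod_less_divisor[of p "y ^ u"] by linarith
    ultimately have "y ^ u mod p \<in> {1..p - 1}"
      by (auto simp: Suc_le_eq mod_greater_zero_iff_not_dvd)
    with * show "\<exists>g\<in>{1..p - 1}. [g ^ h = x] (mod p)" by blast
  }
qed

text \<open>Subtracting \<open>1 / e\<close> on all nonzero residues kills the zeroth Fourier coefficient, so that
  no error term arises from the main term.\<close>

lemma power_residues_multiples_le:
  assumes "prime p" "e dvd p - 1" "\<not> p dvd D" "D * N < p"
  shows "\<bar>\<Sum>a=1..N. of_bool (D * a \<in> power_residues p e) - 1 / real e\<bar>
    \<le> sqrt (real p) * (1 + ln (real p))"
proof -
  have p1: "p > 1" using assms(1) prime_gt_1_nat by simp
  have e0: "e > 0" using assms(2) p1 by (auto intro: Nat.gr0I)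
  define P where "P = power_residues p e"
  define f :: "nat \<Rightarrow> real" where "f = (\<lambda>x. of_bool (x \<in> P) - (if x = 0 then 0 else 1 / real e))"
  have P: "P \<subseteq> {1..<p}" by (auto simp: P_def power_residues_def)
  have cP: "real (card P) = (real p - 1) / real e"
    using card_power_residues[OF assms(1,2)] assms(2) p1
    by (simp add: P_def real_of_nat_div of_nat_diff)
  have "1 \<in> P" unfolding P_def power_residues_def using p1 by (auto intro!: exI[of _ 1])
  then have ne: "P \<noteq> {}" by blast
  have split: "(\<Sum>x<p. g x) = g 0 + (\<Sum>x\<in>{1..<p}. g x)" for g :: "nat \<Rightarrow> real"
  proof -
    have "{..<p} = insert 0 {1..<p}" using p1 by auto
    then show ?thesis by simp
  qed
  have sumP: "(\<Sum>x\<in>{1..<p}. of_bool (x \<in> P) :: real) = real (card P)"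
  proof -
    have "{1..<p} \<inter> P = P" using P by blast
    then show ?thesis by (simp add: of_bool_def sum.If_cases)
  qed
  have f0: "f 0 = 0" using P by (auto simp: f_def)
  have mean: "(\<Sum>x<p. f x) = 0"
  proof -
    have "(\<Sum>x<p. f x) = (\<Sum>x\<in>{1..<p}. of_bool (x \<in> P) - 1 / real e)"
      unfolding split f0 by (simp add: f_def)
    also have "\<dots> = 0" using p1 unfolding sum_subtractf sumP cP by (simp add: of_nat_diff)
    finally show ?thesis .
  qed
  have L2: "(\<Sum>x<p. (f x)\<^sup>2) \<le> real (card P)"
  proof -
    \<comment> \<open>For \<open>x \<noteq> 0\<close> the value of \<open>f\<close> is
      \<open>1 - 1 / e\<close> on \<open>P\<close> and \<open>- 1 / e\<close> elsewhere; both values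
      satisfy this identity, which is linear in \<open>f\<close>, and the last term then sums to
      0.\<close>
    have "(\<Sum>x<p. (f x)\<^sup>2) = (\<Sum>x\<in>{1..<p}. (1 - 1 / real e) * of_bool (x \<in> P)
        - 1 / real e * f x)"
      unfolding split f0
      by simp (intro sum.cong refl, use e0 in \<open>auto simp: f_def power2_eq_square field_simps\<close>)
    also have "\<dots> = (1 - 1 / real e) * real (card P) - 1 / real e * (\<Sum>x\<in>{1..<p}. f x)"
      by (simp only: sum_subtractf sumP flip: sum_distrib_left)
    also have "\<dots> = (1 - 1 / real e) * real (card P)"
      using mean unfolding split f0 by simp
    also have "\<dots> \<le> 1 * real (card P)" by (intro mult_right_mono) auto
    finally show ?thesis by simp
  qed
  have inv: "f (h * x mod p) = f x" if "h \<in> P" "x < p" for h x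
  proof -
    have "\<not> p dvd h" using that P by (auto dest!: dvd_imp_le)
    then have "h * x mod p = 0 \<longleftrightarrow> x = 0"
      using that assms(1) by (auto simp: prime_dvd_mult_iff simp flip: dvd_eq_mod_eq_0 dest!: dvd_imp_le)
    then show ?thesis
      using mult_mod_in_power_residues_iff[OF assms(1), of h e x] that by (simp add: f_def P_def)
  qed
  have "\<bar>\<Sum>a=1..N. f (D * a mod p)\<bar> \<le> sqrt (real p) * (1 + ln (real p))"
    by (rule incomplete_sum_le[OF assms(1) P ne inv L2 mean assms(3)])
  also have "(\<Sum>a=1..N. f (D * a mod p)) = (\<Sum>a=1..N. of_bool (D * a \<in> power_residues p e) - 1 / real e)"
  proof (intro sum.cong refl)
    fix a assume a: "a \<in> {1..N}"
    \<comment> \<open>All multiples stay strictly between 0 and \<open>p\<close>, so reduction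
      modulo \<open>p\<close> changes nothing and the exceptional value \<open>f 0\<close> is never
      met.\<close>
    then have "D * a \<le> D * N" by simp
    then have "D * a < p" using assms(4) by (rule le_less_trans)
    moreover have "D * a \<noteq> 0" using a assms(3) by (cases "D = 0") auto
    ultimately show "f (D * a mod p) = of_bool (D * a \<in> power_residues p e) - 1 / real e"
      by (simp add: f_def P_def)
  qed
  finally show ?thesis .
qed

section \<open>Inclusion-exclusion over prime factors\<close>

lemma prod_primes_dvd_iff:
  fixes a :: nat
  assumes "finite A" "\<And>q. q \<in> A \<Longrightarrow> prime q"
  shows "\<Prod>A dvd a \<longleftrightarrow> (\<forall>q\<in>A. q dvd a)"
  using assms
proof (induction A rule: finite_induct)
  case (insert q A)
  have "coprime q (\<Prod>A)"
    using insert.hyps insert.prems by (intro prod_coprime_right primes_coprime) auto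
  then have "q * \<Prod>A dvd a \<longleftrightarrow> q dvd a \<and> \<Prod>A dvd a"
    by (auto intro: divides_mult dest: dvd_mult_left dvd_mult_right)
  with insert show ?case by simp
qed simp

text \<open>Expansion of the product of \<open>1 - of_bool (q dvd a)\<close> over
  \<open>q \<in> P\<close>, with one term for each subset of \<open>P\<close>.\<close>

lemma of_bool_no_prime_dvd_eq_sum:
  fixes a :: nat
  assumes "finite P" "\<And>q. q \<in> P \<Longrightarrow> prime q"
  shows "of_bool (\<forall>q\<in>P. \<not> q dvd a) = (\<Sum>A\<in>Pow P. (-1) ^ card A * of_bool (\<Prod>A dvd a) :: real)"
proof -
  have "of_bool (\<forall>q\<in>P. \<not> q dvd a) = (\<Prod>q\<in>P. - of_bool (q dvd a) + 1 :: real)"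
    using assms(1) by (auto simp: of_bool_def prod_zero_iff)
  also have "\<dots> = (\<Sum>A\<in>Pow P. \<Prod>q\<in>A. - of_bool (q dvd a))"
    using assms(1) by (subst prod_add) auto
  also have "\<dots> = (\<Sum>A\<in>Pow P. (-1) ^ card A * of_bool (\<Prod>A dvd a))"
  proof (intro sum.cong refl)
    fix A assume "A \<in> Pow P"
    then have A: "finite A" "\<And>q. q \<in> A \<Longrightarrow> prime q" using assms finite_subset by auto
    have "(\<Prod>q\<in>A. - of_bool (q dvd a) :: real) = (\<Prod>q\<in>A. -1 * of_bool (q dvd a))" by simp
    also have "\<dots> = (-1) ^ card A * (\<Prod>q\<in>A. of_bool (q dvd a))"
      by (simp only: prod.distrib prod_constant)
    also have "(\<Prod>q\<in>A. of_bool (q dvd a) :: real) = of_bool (\<Prod>A dvd a)"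
      using A by (auto simp: prod_primes_dvd_iff of_bool_def prod_zero_iff)
    finally show "(\<Prod>q\<in>A. - of_bool (q dvd a) :: real) = (-1) ^ card A * of_bool (\<Prod>A dvd a)" .
  qed
  finally show ?thesis .
qed

text \<open>Moebius inversion, with squarefree divisors encoded as sets of primes and
  \<open>(-1) ^ card A\<close> as the Moebius function. Multiples of \<open>\<Prod>A\<close> are
  parametrised as \<open>\<Prod>A * b\<close>.\<close>

lemma sum_coprime_eq:
  fixes F :: "nat \<Rightarrow> real"
  assumes "m > 0"
  shows "(\<Sum>a | a \<in> {1..m} \<and> coprime a m. F a)
    = (\<Sum>A\<in>Pow (prime_factors m). (-1) ^ card A * (\<Sum>b=1..m div \<Prod>A. F (\<Prod>A * b)))"
proof -
  have "(\<Sum>a | a \<in> {1..m} \<and> coprime a m. F a) = (\<Sum>a=1..m. of_bool (coprime a m) * F a)"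
    by (intro sum.mono_neutral_cong_left) auto
  also have "\<dots> = (\<Sum>a=1..m. \<Sum>A\<in>Pow (prime_factors m). (-1) ^ card A * (of_bool (\<Prod>A dvd a) * F a))"
  proof (intro sum.cong refl)
    fix a
    have "coprime a m \<longleftrightarrow> (\<forall>q\<in>prime_factors m. \<not> q dvd a)"
    proof
      assume "coprime a m"
      then show "\<forall>q\<in>prime_factors m. \<not> q dvd a"
        using coprime_common_divisor not_prime_unit unfolding in_prime_factors_iff by blast
    next
      assume *: "\<forall>q\<in>prime_factors m. \<not> q dvd a"
      show "coprime a m"
      proof (rule ccontr)
        assume "\<not> coprime a m"
        then obtain q where "prime q" "q dvd gcd a m"
          using prime_factor_nat[of "gcd a m"] unfolding coprime_iff_gcd_eq_1 by blast
        then have "q \<in> prime_factors m" "q dvd a"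
          using assms by (simp_all add: in_prime_factors_iff)
        with * show False by blast
      qed
    qed
    moreover have "of_bool (\<forall>q\<in>prime_factors m. \<not> q dvd a)
        = (\<Sum>A\<in>Pow (prime_factors m). (-1) ^ card A * of_bool (\<Prod>A dvd a) :: real)"
      by (rule of_bool_no_prime_dvd_eq_sum) auto
    ultimately show "of_bool (coprime a m) * F a
        = (\<Sum>A\<in>Pow (prime_factors m). (-1) ^ card A * (of_bool (\<Prod>A dvd a) * F a))"
      by (simp only: sum_distrib_right mult.assoc)
  qed
  also have "\<dots> = (\<Sum>A\<in>Pow (prime_factors m). (-1) ^ card A * (\<Sum>a=1..m. of_bool (\<Prod>A dvd a) * F a))"
    by (subst sum.swap) (simp only: sum_distrib_left)
  also have "\<dots> = (\<Sum>A\<in>Pow (prime_factors m). (-1) ^ card A * (\<Sum>b=1..m div \<Prod>A. F (\<Prod>A * b)))"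
  proof (rule sum.cong[OF refl])
    fix A assume "A \<in> Pow (prime_factors m)"
    then have "0 \<notin> A" "finite A" by (auto intro: finite_subset)
    then have d: "\<Prod>A > 0" by (intro Nat.gr0I) auto
    have "(\<Sum>a=1..m. of_bool (\<Prod>A dvd a) * F a) = (\<Sum>a | a \<in> {1..m} \<and> \<Prod>A dvd a. F a)"
      by (intro sum.mono_neutral_cong_right) auto
    also have "\<dots> = (\<Sum>b=1..m div \<Prod>A. F (\<Prod>A * b))"
      using d
      by (intro sum.reindex_bij_witness[of _ "\<lambda>b. \<Prod>A * b" "\<lambda>a. a div \<Prod>A"])
        (auto simp: less_eq_div_iff_mult_less_eq mult.commute div_le_mono Suc_le_eq
          div_greater_zero_iff dvd_imp_le)
    finally show "(-1) ^ card A * (\<Sum>a=1..m. of_bool (\<Prod>A dvd a) * F a)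
        = (-1) ^ card A * (\<Sum>b=1..m div \<Prod>A. F (\<Prod>A * b))" by (rule arg_cong)
  qed
  finally show ?thesis .
qed

text \<open>The subsets correspond to the squarefree divisors of \<open>m\<close>: \<open>A\<close>
  is recovered from \<open>\<Prod>A\<close> as its set of prime factors.\<close>

lemma card_Pow_prime_factors_le:
  fixes m :: nat
  assumes "m > 0"
  shows "card (Pow (prime_factors m)) \<le> divisor_count m"
  unfolding divisor_count_def
proof (rule card_inj_on_le[where f = "\<lambda>A. \<Prod>A"])
  have pf: "prime_factors (\<Prod>A) = A" if "A \<in> Pow (prime_factors m)" for A
  proof -
    have A: "finite A" "\<And>q. q \<in> A \<Longrightarrow> prime q" using that finite_subset by auto
    then have "0 \<notin> A" using not_prime_0 by blast
    then have "prime_factors (\<Prod>A) = (\<Union>q\<in>A. prime_factors q)"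
      using A by (subst prime_factors_prod) auto
    also have "\<dots> = A" using A by (auto simp: prime_prime_factors)
    finally show ?thesis .
  qed
  show "inj_on (\<lambda>A. \<Prod>A) (Pow (prime_factors m))"
    using pf by (rule inj_on_inverseI)
  show "(\<lambda>A. \<Prod>A) ` Pow (prime_factors m) \<subseteq> {e. e dvd m}"
  proof safe
    fix A assume "A \<subseteq> prime_factors m"
    then have "finite A" "\<And>q. q \<in> A \<Longrightarrow> prime q" "\<forall>q\<in>A. q dvd m"
      using finite_subset by auto
    then show "\<Prod>A dvd m" using prod_primes_dvd_iff by blast
  qed
  show "finite {e. e dvd m}" using assms by simp
qed

lemma divisor_count_mono:
  assumes "m dvd n" "n > 0"
  shows "divisor_count m \<le> divisor_count n"
  unfolding divisor_count_def using assms by (intro card_mono) (auto intro: dvd_trans)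

text \<open>The coprimality condition turns into signed sums over multiples of
  \<open>e * \<Prod>A\<close>, each bounded by \<open>B\<close>; the number of sets \<open>A\<close>
  is at most \<open>divisor_count (p - 1)\<close>.\<close>

lemma coprime_power_residues_le:
  assumes "prime p" "e dvd p - 1"
  defines "m \<equiv> (p - 1) div e"
  shows "\<bar>real (card {a \<in> {1..m}. coprime a m \<and> e * a \<in> power_residues p e}) - 1 / real e * real (totient m)\<bar>
    \<le> real (divisor_count (p - 1)) * (sqrt (real p) * (1 + ln (real p)))"
proof -
  define B where "B = sqrt (real p) * (1 + ln (real p))"
  define F :: "nat \<Rightarrow> real" where "F = (\<lambda>a. of_bool (e * a \<in> power_residues p e) - 1 / real e)"
  have p1: "p > 1" using assms(1) prime_gt_1_nat by simp
  have em: "e * m = p - 1" using assms(2) by (simp add: m_def)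
  then have m0: "m > 0" using p1 by (auto intro: Nat.gr0I)
  have B0: "B \<ge> 0" using p1 by (auto simp: B_def intro!: mult_nonneg_nonneg add_nonneg_nonneg)
  have tot: "{a \<in> {1..m}. coprime a m} = totatives m"
    by (auto simp: totatives_def)
  have "real (card {a \<in> {1..m}. coprime a m \<and> e * a \<in> power_residues p e}) - 1 / real e * real (totient m)
      = (\<Sum>a | a \<in> {1..m} \<and> coprime a m. F a)"
  proof -
    have "{a \<in> {1..m}. coprime a m \<and> e * a \<in> power_residues p e}
        = {a \<in> totatives m. e * a \<in> power_residues p e}" unfolding tot[symmetric] by auto
    then show ?thesis
      unfolding F_def sum_subtractf tot
      by (simp add: totient_def of_bool_def sum.If_cases Int_def conj_commute)
  qed
  also have "\<dots> = (\<Sum>A\<in>Pow (prime_factors m). (-1) ^ card A * (\<Sum>b=1..m div \<Prod>A. F (\<Prod>A * b)))"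
    by (rule sum_coprime_eq[OF m0])
  finally have "\<bar>real (card {a \<in> {1..m}. coprime a m \<and> e * a \<in> power_residues p e})
        - 1 / real e * real (totient m)\<bar>
      \<le> (\<Sum>A\<in>Pow (prime_factors m). \<bar>(-1) ^ card A * (\<Sum>b=1..m div \<Prod>A. F (\<Prod>A * b))\<bar>)"
    by simp
  also have "\<dots> \<le> (\<Sum>A\<in>Pow (prime_factors m). B)"
  proof (rule sum_mono)
    fix A assume "A \<in> Pow (prime_factors m)"
    then have "finite A" "\<And>q. q \<in> A \<Longrightarrow> prime q" "\<forall>q\<in>A. q dvd m"
      using finite_subset by auto
    then have Am: "\<Prod>A dvd m" using prod_primes_dvd_iff by blast
    then have "e * \<Prod>A dvd p - 1" unfolding em[symmetric] by simp
    then have "e * \<Prod>A \<le> p - 1" "e * \<Prod>A > 0" using p1 by (auto dest: dvd_imp_le intro: Nat.gr0I)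
    then have nd: "\<not> p dvd e * \<Prod>A" using p1 by (auto dest!: dvd_imp_le)
    \<comment> \<open>With \<open>D = e * \<Prod>A\<close> and \<open>N = m div \<Prod>A\<close> the
      multiples end at \<open>p - 1\<close>, which is the required \<open>D * N < p\<close>.\<close>
    have "e * \<Prod>A * (m div \<Prod>A) = p - 1" using Am em by (simp add: mult.assoc)
    then have "\<bar>\<Sum>b=1..m div \<Prod>A. F (\<Prod>A * b)\<bar> \<le> B"
      using power_residues_multiples_le[OF assms(1,2) nd, of "m div \<Prod>A"] p1
      by (simp add: F_def B_def mult.assoc)
    then show "\<bar>(-1) ^ card A * (\<Sum>b=1..m div \<Prod>A. F (\<Prod>A * b))\<bar> \<le> B"
      by (simp add: abs_mult power_abs)
  qed
  also have "\<dots> = real (card (Pow (prime_factors m))) * B" by simp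
  also have "\<dots> \<le> real (divisor_count (p - 1)) * B"
  proof (intro mult_right_mono B0 of_nat_mono)
    have "m dvd p - 1" unfolding em[symmetric] by simp
    then show "card (Pow (prime_factors m)) \<le> divisor_count (p - 1)"
      using card_Pow_prime_factors_le[OF m0] divisor_count_mono[of m "p - 1"] p1 by simp
  qed
  finally show ?thesis by (simp add: B_def)
qed

section \<open>Splitting by the gcd with \<open>p - 1\<close> and the final estimate\<close>

text \<open>The numbers \<open>h\<close> are sorted by \<open>e = gcd h (p - 1)\<close>, which
  decides the relevant power residues; writing \<open>h = e * a\<close> makes the gcd condition a
  coprimality condition on \<open>a\<close>.\<close>

lemma G_eq_sum_coprime_power_residues:
  assumes "prime p"
  shows "G p = (\<Sum>e | e dvd p - 1.
    card {a \<in> {1..(p - 1) div e}. coprime a ((p - 1) div e) \<and> e * a \<in> power_residues p e})"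
proof -
  define n where "n = p - 1"
  have p1: "p > 1" using assms prime_gt_1_nat by simp
  then have n0: "n > 0" and np: "{1..n} = {1..<p}" by (auto simp: n_def)
  have "{h \<in> {1..n}. \<exists>g \<in> {1..n}. [g ^ h = h] (mod p)}
      = (\<Union>e\<in>{e. e dvd n}. {h \<in> {1..n}. gcd h n = e \<and> h \<in> power_residues p e})"
  proof -
    have "(\<exists>g \<in> {1..n}. [g ^ h = h] (mod p)) \<longleftrightarrow> h \<in> power_residues p (gcd h n)"
      if "h \<in> {1..n}" for h
      \<comment> \<open>Here \<open>h\<close> is both the exponent and the target residue.\<close>
      using ex_power_cong_iff[OF assms, of h h] that unfolding np[symmetric] n_def by simp
    then show ?thesis by auto
  qed
  then have "G p = card (\<Union>e\<in>{e. e dvd n}. {h \<in> {1..n}. gcd h n = e \<and> h \<in> power_residues p e})"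
    by (simp add: G_def n_def)
  also have "\<dots> = (\<Sum>e | e dvd n. card {h \<in> {1..n}. gcd h n = e \<and> h \<in> power_residues p e})"
    using n0 by (intro card_UN_disjoint) auto
  also have "\<dots> = (\<Sum>e | e dvd n.
    card {a \<in> {1..n div e}. coprime a (n div e) \<and> e * a \<in> power_residues p e})"
  proof (intro sum.cong refl)
    fix e assume "e \<in> {e. e dvd n}"
    then obtain m where m: "n = e * m" by (auto elim: dvdE)
    then have e0: "e > 0" using n0 by (auto intro: Nat.gr0I)
    have gcd: "gcd (e * a) n = e \<longleftrightarrow> coprime a m" for a
      using e0 unfolding m gcd_mult_distrib_nat[symmetric] coprime_iff_gcd_eq_1 by simp
    have "bij_betw (\<lambda>a. e * a) {a \<in> {1..m}. coprime a m \<and> e * a \<in> power_residues p e}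
        {h \<in> {1..n}. gcd h n = e \<and> h \<in> power_residues p e}"
    proof (rule bij_betw_imageI)
      show "inj_on (\<lambda>a. e * a) {a \<in> {1..m}. coprime a m \<and> e * a \<in> power_residues p e}"
        using e0 by (auto simp: inj_on_def)
      show "(\<lambda>a. e * a) ` {a \<in> {1..m}. coprime a m \<and> e * a \<in> power_residues p e}
          = {h \<in> {1..n}. gcd h n = e \<and> h \<in> power_residues p e}"
      proof (intro equalityI subsetI)
        fix h assume h: "h \<in> {h \<in> {1..n}. gcd h n = e \<and> h \<in> power_residues p e}"
        then have "e dvd h" by (auto intro: gcd_dvd1)
        then obtain a where a: "h = e * a" by (rule dvdE)
        then have "coprime a m" using gcd h by simp
        moreover have "a \<in> {1..m}" using h a e0 by (auto simp: m Suc_le_eq)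
        ultimately show "h \<in> (\<lambda>a. e * a) ` {a \<in> {1..m}. coprime a m \<and> e * a \<in> power_residues p e}"
          using h a by auto
      next
        fix h assume "h \<in> (\<lambda>a. e * a) ` {a \<in> {1..m}. coprime a m \<and> e * a \<in> power_residues p e}"
        then show "h \<in> {h \<in> {1..n}. gcd h n = e \<and> h \<in> power_residues p e}"
          using gcd e0 by (auto simp: Suc_le_eq) (auto simp: m)
      qed
    qed
    then have "card {h \<in> {1..n}. gcd h n = e \<and> h \<in> power_residues p e}
        = card {a \<in> {1..m}. coprime a m \<and> e * a \<in> power_residues p e}"
      by (rule bij_betw_same_card[symmetric])
    moreover have "n div e = m" using e0 by (simp add: m)
    ultimately show "card {h \<in> {1..n}. gcd h n = e \<and> h \<in> power_residues p e}
      = card {a \<in> {1..n div e}. coprime a (n div e) \<and> e * a \<in> power_residues p e}" by simp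
  qed
  finally show ?thesis by (simp add: n_def)
qed

theorem theorem6:
  fixes p :: nat
  assumes "prime p"
  shows "\<bar>real (G p) - (\<Sum>e | e dvd p - 1. 1 / real e * real (totient ((p - 1) div e)))\<bar>
    \<le> real (divisor_count (p - 1)) ^ 2 * sqrt (real p) * (1 + ln (real p))"
proof -
  define c where "c = (\<lambda>e. card {a \<in> {1..(p - 1) div e}.
    coprime a ((p - 1) div e) \<and> e * a \<in> power_residues p e})"
  define B where "B = real (divisor_count (p - 1)) * (sqrt (real p) * (1 + ln (real p)))"
  have "\<bar>real (G p) - (\<Sum>e | e dvd p - 1. 1 / real e * real (totient ((p - 1) div e)))\<bar>
      = \<bar>\<Sum>e | e dvd p - 1. real (c e) - 1 / real e * real (totient ((p - 1) div e))\<bar>"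
    unfolding G_eq_sum_coprime_power_residues[OF assms] c_def by (simp only: sum_subtractf of_nat_sum)
  also have "\<dots> \<le> (\<Sum>e | e dvd p - 1. \<bar>real (c e) - 1 / real e * real (totient ((p - 1) div e))\<bar>)"
    by (rule sum_abs)
  \<comment> \<open>The error \<open>B\<close> already contains one factor
    \<open>divisor_count (p - 1)\<close>; the number of divisors \<open>e\<close> supplies the
    other.\<close>
  also have "\<dots> \<le> (\<Sum>e | e dvd p - 1. B)"
    unfolding c_def B_def by (intro sum_mono coprime_power_residues_le assms) simp
  also have "\<dots> = real (divisor_count (p - 1)) ^ 2 * sqrt (real p) * (1 + ln (real p))"
    by (simp add: B_def divisor_count_def power2_eq_square)
  finally show ?thesis .
qed

end
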